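(* If $G$ is a line perfect graph, then $\chi'_{trans}(G)\leq 4$.
   Context: Graphs are finite and simple. A graph is line perfect if its line graph is a perfect graph. A proper $t$-coloring of $G$ is a map $E(G)\to\{1,\dots,t\}$ with adjacent edges receiving distinct colors; $\chi'(G)$ is the chromatic index; $M(f,j)$ is the set of edges of color $j$. Two $t$-colorings differ by at most $n$ color classes if the number of colors $j$ with $M(f,j)\neq M(g,j)$ is at most $n$; proper $t$-colorings $f,g$ are $n$-equivalent if there is a sequence $f_0=f,\dots,f_k=g$ ($k\geq 1$) of proper $t$-colorings with consecutive ones differing by at most $n$ color classes. $\chi'_{trans}(G)$ is the minimum integer $n\geq 2$ such that any two proper $\chi'(G)$-colorings of $G$ are $n$-equivalent. *)

theory Defs
  imports Main "HOL-Library.FuncSet"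
begin

type_synonym 'a graph = "'a set \<times> 'a set set"

abbreviation verts :: "'a graph \<Rightarrow> 'a set" where "verts G \<equiv> fst G"
abbreviation edges :: "'a graph \<Rightarrow> 'a set set" where "edges G \<equiv> snd G"

definition simple_graph :: "'a graph \<Rightarrow> bool" where
  "simple_graph G \<longleftrightarrow> finite (verts G) \<and> (\<forall>e\<in>edges G. e \<subseteq> verts G \<and> card e = 2)"

definition induced_subgraph :: "'a graph \<Rightarrow> 'a set \<Rightarrow> 'a graph" where
  "induced_subgraph G U = (U, {e \<in> edges G. e \<subseteq> U})"

definition proper_vertex_coloring :: "'a graph \<Rightarrow> nat \<Rightarrow> ('a \<Rightarrow> nat) \<Rightarrow> bool" where
  "proper_vertex_coloring G k c \<longleftrightarrow>
     c \<in> verts G \<rightarrow>\<^sub>E {1..k} \<and> (\<forall>u v. {u, v} \<in> edges G \<longrightarrow> c u \<noteq> c v)"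

definition chromatic_number :: "'a graph \<Rightarrow> nat" where
  "chromatic_number G = (LEAST k. \<exists>c. proper_vertex_coloring G k c)"

definition clique :: "'a graph \<Rightarrow> 'a set \<Rightarrow> bool" where
  "clique G K \<longleftrightarrow> K \<subseteq> verts G \<and> (\<forall>u\<in>K. \<forall>v\<in>K. u \<noteq> v \<longrightarrow> {u, v} \<in> edges G)"

definition clique_number :: "'a graph \<Rightarrow> nat" where
  "clique_number G = Max {card K | K. clique G K}"

definition perfect_graph :: "'a graph \<Rightarrow> bool" where
  "perfect_graph G \<longleftrightarrow>
     (\<forall>U \<subseteq> verts G. chromatic_number (induced_subgraph G U) = clique_number (induced_subgraph G U))"

definition adjacent_edges :: "'a set \<Rightarrow> 'a set \<Rightarrow> bool" where
  "adjacent_edges e e' \<longleftrightarrow> e \<noteq> e' \<and> e \<inter> e' \<noteq> {}"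

definition line_graph :: "'a graph \<Rightarrow> 'a set graph" where
  "line_graph G = (edges G, {{e, e'} | e e'. e \<in> edges G \<and> e' \<in> edges G \<and> adjacent_edges e e'})"

definition line_perfect :: "'a graph \<Rightarrow> bool" where
  "line_perfect G \<longleftrightarrow> perfect_graph (line_graph G)"

definition proper_coloring :: "'a graph \<Rightarrow> nat \<Rightarrow> ('a set \<Rightarrow> nat) \<Rightarrow> bool" where
  "proper_coloring G t f \<longleftrightarrow>
     f \<in> edges G \<rightarrow>\<^sub>E {1..t} \<and>
     (\<forall>e\<in>edges G. \<forall>e'\<in>edges G. adjacent_edges e e' \<longrightarrow> f e \<noteq> f e')"

definition chromatic_index :: "'a graph \<Rightarrow> nat" where
  "chromatic_index G = (LEAST t. \<exists>f. proper_coloring G t f)"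

definition color_class :: "'a graph \<Rightarrow> ('a set \<Rightarrow> nat) \<Rightarrow> nat \<Rightarrow> 'a set set" where
  "color_class G f j = {e \<in> edges G. f e = j}"

definition differ_by_at_most ::
  "'a graph \<Rightarrow> nat \<Rightarrow> nat \<Rightarrow> ('a set \<Rightarrow> nat) \<Rightarrow> ('a set \<Rightarrow> nat) \<Rightarrow> bool" where
  "differ_by_at_most G t n f g \<longleftrightarrow>
     card {j \<in> {1..t}. color_class G f j \<noteq> color_class G g j} \<le> n"

definition n_equivalent ::
  "'a graph \<Rightarrow> nat \<Rightarrow> nat \<Rightarrow> ('a set \<Rightarrow> nat) \<Rightarrow> ('a set \<Rightarrow> nat) \<Rightarrow> bool" where
  "n_equivalent G t n f g \<longleftrightarrow>
     (\<exists>k (h :: nat \<Rightarrow> 'a set \<Rightarrow> nat). k \<ge> 1 \<and> h 0 = f \<and> h k = g \<and>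
        (\<forall>i\<le>k. proper_coloring G t (h i)) \<and>
        (\<forall>i<k. differ_by_at_most G t n (h i) (h (Suc i))))"

text \<open>The minimum exists for every finite simple graph: any two proper \<open>t\<close>-colorings are
  \<open>t\<close>-equivalent, so \<open>n = max 2 t\<close> with \<open>t\<close> the chromatic index satisfies the condition.\<close>

definition chi_trans :: "'a graph \<Rightarrow> nat" where
  "chi_trans G = (LEAST n. n \<ge> 2 \<and>
     (\<forall>f g. proper_coloring G (chromatic_index G) f \<longrightarrow> proper_coloring G (chromatic_index G) g \<longrightarrow>
        n_equivalent G (chromatic_index G) n f g))"

end

theory Submission imports Defs
begin

text \<open>
  Perfection of the line graph is used only through one consequence: for every \<open>k \<ge> 3\<close>, a set of
  edges of maximum degree at most \<open>k\<close> is \<open>k\<close>-edge-colorable, because a clique of a line graph is a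
  star or a triangle. This alone makes any two colorings equivalent under recolorings of \<open>k + 1\<close>
  classes.

  By induction on the number of colors it suffices to move \<open>f\<close> to a coloring whose class \<open>t\<close>
  contains the class \<open>M\<close> of color \<open>t\<close> under \<open>g\<close>: then \<open>g\<close> can be recolored edge by edge to have
  that same class, which is removed. Fix a set \<open>S\<close> of \<open>k + 1\<close> colors containing \<open>t\<close>, let \<open>H\<close> be the
  edges with color in \<open>S\<close>, and let \<open>F\<close> be a matching in \<open>H\<close> such that \<open>H - F\<close> has at most two
  vertices of degree \<open>k + 1\<close>. Such an \<open>F\<close> need not be a color class, but it can be driven towards
  \<open>M\<close> by exchanging edges, since an exchange never leaves more than two vertices of excessive
  degree. If an edge to be exchanged has a color \<open>c\<close> outside \<open>S\<close>, a matching \<open>N\<close> of \<open>H - F\<close> is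
  found such that \<open>H - N\<close> has maximum degree at most \<open>k\<close>; recoloring \<open>H\<close> so that \<open>N\<close> becomes a
  class frees one color of \<open>S\<close>, which is replaced by \<open>c\<close>. A vertex of excessive degree not covered
  by \<open>M\<close> has fewer edges than there are colors, so \<open>f\<close> misses a color at it; bringing that color
  into \<open>S\<close> in the same way lowers its degree. Once \<open>H - F\<close> has maximum degree at most \<open>k\<close>, \<open>F\<close>
  itself becomes the class \<open>t\<close>.
\<close>

section \<open>Sets of edges and their colorings\<close>

definition edges_at :: "'a set set \<Rightarrow> 'a \<Rightarrow> 'a set set" where
  "edges_at K v = {e \<in> K. v \<in> e}"

definition degree :: "'a set set \<Rightarrow> 'a \<Rightarrow> nat" where
  "degree K v = card (edges_at K v)"

definition matching :: "'a set set \<Rightarrow> bool" where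
  "matching F \<longleftrightarrow> pairwise disjnt F"

definition proper_on :: "'a set set \<Rightarrow> 'c set \<Rightarrow> ('a set \<Rightarrow> 'c) \<Rightarrow> bool" where
  "proper_on K C f \<longleftrightarrow> f ` K \<subseteq> C \<and> (\<forall>v. inj_on f (edges_at K v))"

definition colored :: "'a set set \<Rightarrow> ('a set \<Rightarrow> 'c) \<Rightarrow> 'c set \<Rightarrow> 'a set set" where
  "colored K f S = {e \<in> K. f e \<in> S}"

definition missing_colors :: "'a set set \<Rightarrow> 'c set \<Rightarrow> ('a set \<Rightarrow> 'c) \<Rightarrow> 'a \<Rightarrow> 'c set" where
  "missing_colors K C f v = C - f ` edges_at K v"

lemma edges_at_Un: "edges_at (A \<union> B) v = edges_at A v \<union> edges_at B v"
  by (auto simp: edges_at_def)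

lemma edges_at_Diff: "edges_at (A - B) v = edges_at A v - edges_at B v"
  by (auto simp: edges_at_def)

lemma edges_at_mono: "A \<subseteq> B \<Longrightarrow> edges_at A v \<subseteq> edges_at B v"
  by (auto simp: edges_at_def)

lemma edges_at_eq_empty_iff: "edges_at K v = {} \<longleftrightarrow> v \<notin> \<Union>K"
  by (auto simp: edges_at_def)

lemma finite_edges_at [simp]: "finite K \<Longrightarrow> finite (edges_at K v)"
  by (simp add: edges_at_def)

lemma degree_eq_0: "v \<notin> \<Union>K \<Longrightarrow> degree K v = 0"
  by (metis card.empty degree_def edges_at_eq_empty_iff)

lemma degree_mono: "finite B \<Longrightarrow> A \<subseteq> B \<Longrightarrow> degree A v \<le> degree B v"
  by (simp add: degree_def card_mono edges_at_mono)

lemma degree_subset_Un_le: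
  assumes "A \<subseteq> B \<union> C" "finite B" "finite C"
  shows "degree A v \<le> degree B v + degree C v"
proof -
  have "degree A v \<le> degree (B \<union> C) v"
    using assms by (intro degree_mono) auto
  also have "\<dots> \<le> degree B v + degree C v"
    by (simp add: degree_def edges_at_Un card_Un_le)
  finally show ?thesis .
qed

lemma degree_Diff: "finite B \<Longrightarrow> B \<subseteq> A \<Longrightarrow> degree (A - B) v = degree A v - degree B v"
  by (simp add: degree_def edges_at_Diff edges_at_mono card_Diff_subset)

lemma degree_Diff_less:
  assumes "finite A" "B \<subseteq> A" "v \<in> \<Union>B"
  shows "degree (A - B) v < degree A v"
  unfolding degree_def using assms by (intro psubset_card_mono) (auto simp: edges_at_def)

lemma sum_degree_eq:
  assumes "finite K" "finite Z"
  shows "(\<Sum>v\<in>Z. degree K v) = (\<Sum>e\<in>K. card (e \<inter> Z))"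
proof -
  have "(\<Sum>v\<in>Z. degree K v) = (\<Sum>v\<in>Z. \<Sum>e | e \<in> K \<and> v \<in> e. 1)"
    by (simp add: degree_def edges_at_def)
  also have "\<dots> = (\<Sum>e\<in>K. \<Sum>v | v \<in> Z \<and> v \<in> e. 1)"
    using assms(2,1) by (rule sum.swap_restrict)
  also have "\<dots> = (\<Sum>e\<in>K. card (e \<inter> Z))"
    by (simp add: Int_commute flip: Int_def Collect_conj_eq)
  finally show ?thesis .
qed

lemma matchingD: "matching F \<Longrightarrow> e \<in> F \<Longrightarrow> e' \<in> F \<Longrightarrow> v \<in> e \<Longrightarrow> v \<in> e' \<Longrightarrow> e = e'"
  unfolding matching_def pairwise_def disjnt_iff by blast

lemma matching_edges_at: "matching F \<Longrightarrow> e \<in> F \<Longrightarrow> v \<in> e \<Longrightarrow> edges_at F v = {e}"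
  by (auto simp: edges_at_def dest: matchingD)

lemma matching_degree_le:
  assumes "matching F"
  shows "degree F v \<le> 1"
proof (cases "v \<in> \<Union>F")
  case True
  then obtain e where "edges_at F v = {e}"
    using matching_edges_at[OF assms] by blast
  then show ?thesis
    by (simp add: degree_def)
qed (simp add: degree_eq_0)

lemma proper_onI:
  assumes "\<And>e. e \<in> K \<Longrightarrow> f e \<in> C"
    and "\<And>v e e'. e \<in> K \<Longrightarrow> e' \<in> K \<Longrightarrow> v \<in> e \<Longrightarrow> v \<in> e' \<Longrightarrow> f e = f e' \<Longrightarrow> e = e'"
  shows "proper_on K C f"
  using assms unfolding proper_on_def inj_on_def edges_at_def by blast

lemma proper_on_color: "proper_on K C f \<Longrightarrow> e \<in> K \<Longrightarrow> f e \<in> C"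
  unfolding proper_on_def by blast

lemma proper_on_inj_on: "proper_on K C f \<Longrightarrow> inj_on f (edges_at K v)"
  unfolding proper_on_def by blast

lemma proper_onD:
  "proper_on K C f \<Longrightarrow> e \<in> K \<Longrightarrow> e' \<in> K \<Longrightarrow> v \<in> e \<Longrightarrow> v \<in> e' \<Longrightarrow> f e = f e' \<Longrightarrow> e = e'"
  unfolding proper_on_def inj_on_def edges_at_def by blast

lemma proper_on_subset:
  "proper_on K C f \<Longrightarrow> K' \<subseteq> K \<Longrightarrow> f ` K' \<subseteq> C' \<Longrightarrow> proper_on K' C' f"
  unfolding proper_on_def by (meson edges_at_mono inj_on_subset)

lemma proper_on_comp:
  assumes f: "proper_on K C f" and h: "inj_on h C" "h ` C \<subseteq> C'"
  shows "proper_on K C' (h \<circ> f)"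
  using h by (intro proper_onI) (auto dest: inj_onD proper_on_color[OF f] proper_onD[OF f])

lemma colored_subset: "colored K f S \<subseteq> K"
  by (auto simp: colored_def)

lemma proper_on_colored: "proper_on K C f \<Longrightarrow> proper_on (colored K f S) S f"
  by (rule proper_on_subset) (auto simp: colored_def)

lemma matching_color_class: "proper_on K C f \<Longrightarrow> matching (colored K f {d})"
  unfolding matching_def pairwise_def disjnt_iff colored_def by (auto dest: proper_onD)

lemma card_missing_colors:
  assumes f: "proper_on K C f" and C: "finite C"
  shows "card (missing_colors K C f v) + degree K v = card C"
proof -
  have "f ` edges_at K v \<subseteq> C"
    using proper_on_color[OF f] by (auto simp: edges_at_def)
  moreover have "card (f ` edges_at K v) = degree K v"
    using proper_on_inj_on[OF f] by (simp add: degree_def card_image)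
  ultimately show ?thesis
    unfolding missing_colors_def using C
    by (metis add.commute card_Diff_subset card_mono finite_subset le_add_diff_inverse)
qed

lemma missing_colors_eq_empty_iff:
  assumes "proper_on K C f" "finite C"
  shows "missing_colors K C f v = {} \<longleftrightarrow> degree K v = card C"
proof -
  have "finite (missing_colors K C f v)"
    using assms(2) by (simp add: missing_colors_def)
  then show ?thesis
    using card_missing_colors[OF assms, of v] by (auto simp flip: card_0_eq)
qed

lemma degree_le_card_colors:
  assumes "proper_on K C f" "finite C"
  shows "degree K v \<le> card C"
  using card_missing_colors[OF assms, of v] by simp

lemma proper_on_override_matching:
  assumes f: "proper_on A C f" and B: "matching B" and d: "d \<notin> C"
  shows "proper_on (A \<union> B) (insert d C) (override_on f (\<lambda>_. d) B)"
proof (rule proper_onI)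
  fix v e e'
  assume e: "e \<in> A \<union> B" "e' \<in> A \<union> B" "v \<in> e" "v \<in> e'"
    and eq: "override_on f (\<lambda>_. d) B e = override_on f (\<lambda>_. d) B e'"
  have "e \<in> B \<longleftrightarrow> e' \<in> B"
    using eq e d proper_on_color[OF f] by (auto simp: override_on_def split: if_splits)
  then show "e = e'"
    using e(1,2) eq matchingD[OF B _ _ e(3,4)] proper_onD[OF f _ _ e(3,4)]
    by (auto simp: override_on_def)
qed (auto simp: override_on_def dest: proper_on_color[OF f])

lemma proper_on_override_colored:
  assumes f: "proper_on E T f" and S: "S \<subseteq> T" and h: "proper_on (colored E f S) S h"
  shows "proper_on E T (override_on f h (colored E f S))"
proof (rule proper_onI)
  let ?f = "override_on f h (colored E f S)"
  have in_S_iff: "?f e \<in> S \<longleftrightarrow> e \<in> colored E f S" if "e \<in> E" for e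
    using that proper_on_color[OF h] by (auto simp: override_on_def colored_def)
  show "?f e \<in> T" if "e \<in> E" for e
    using that S proper_on_color[OF f] proper_on_color[OF h] by (auto simp: override_on_def)
  fix v e e'
  assume e: "e \<in> E" "e' \<in> E" "v \<in> e" "v \<in> e'" and eq: "?f e = ?f e'"
  then have "e \<in> colored E f S \<longleftrightarrow> e' \<in> colored E f S"
    using in_S_iff by metis
  then show "e = e'"
    using e eq proper_onD[OF f e] proper_onD[OF h _ _ e(3,4)] by (auto simp: override_on_def)
qed

lemma proper_on_override_enlarging_class:
  assumes g: "proper_on E T g" and t: "t \<in> T"
    and F: "matching F" "colored E g {t} \<subseteq> F" and X: "X \<subseteq> F"
  shows "proper_on E T (override_on g (\<lambda>_. t) X)"
proof (rule proper_onI)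
  fix v e e'
  assume e: "e \<in> E" "e' \<in> E" "v \<in> e" "v \<in> e'"
    and eq: "override_on g (\<lambda>_. t) X e = override_on g (\<lambda>_. t) X e'"
  then consider "e \<in> F" "e' \<in> F" | "g e = g e'"
    using F(2) X by (auto simp: override_on_def colored_def split: if_splits)
  then show "e = e'"
    using e matchingD[OF F(1)] proper_onD[OF g] by cases blast+
qed (auto simp: override_on_def t dest: proper_on_color[OF g])

section \<open>Recoloring steps\<close>

definition recolor_step ::
  "nat \<Rightarrow> 'a set set \<Rightarrow> 'c set \<Rightarrow> ('a set \<Rightarrow> 'c) \<Rightarrow> ('a set \<Rightarrow> 'c) \<Rightarrow> bool" where
  "recolor_step n E T f g \<longleftrightarrow> proper_on E T f \<and> proper_on E T g \<and>
     (\<exists>S. finite S \<and> card S \<le> n \<and> (\<forall>e\<in>E. f e = g e \<or> f e \<in> S \<and> g e \<in> S))"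

lemma recolor_stepI:
  assumes "proper_on E T f" "proper_on E T g" "finite S" "card S \<le> n"
    and "\<And>e. e \<in> E \<Longrightarrow> f e \<noteq> g e \<Longrightarrow> f e \<in> S \<and> g e \<in> S"
  shows "recolor_step n E T f g"
  using assms unfolding recolor_step_def by blast

lemma recolor_step_refl: "proper_on E T f \<Longrightarrow> recolor_step n E T f f"
  by (rule recolor_stepI[where S = "{}"]) auto

lemma symp_recolor_step: "symp (recolor_step n E T)"
  unfolding recolor_step_def by (rule sympI) metis

lemma recolor_steps_proper_on:
  "(recolor_step n E T)\<^sup>*\<^sup>* f g \<Longrightarrow> proper_on E T f \<Longrightarrow> proper_on E T g"
  by (induction rule: rtranclp_induct) (auto simp: recolor_step_def)

lemma recolor_step_override_colored:
  assumes "proper_on E T f" "S \<subseteq> T" "proper_on (colored E f S) S h" "finite S" "card S \<le> n"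
  shows "recolor_step n E T f (override_on f h (colored E f S))"
proof (rule recolor_stepI[OF assms(1) proper_on_override_colored[OF assms(1-3)] assms(4,5)])
  fix e assume "f e \<noteq> override_on f h (colored E f S) e"
  then have "e \<in> colored E f S"
    by (auto simp: override_on_def split: if_splits)
  then show "f e \<in> S \<and> override_on f h (colored E f S) e \<in> S"
    using proper_on_color[OF assms(3)] by (simp add: colored_def)
qed

lemma recolor_steps_enlarge_class:
  assumes n: "2 \<le> n" and g: "proper_on E T g" and t: "t \<in> T"
    and F: "finite F" "matching F" "colored E g {t} \<subseteq> F"
  shows "(recolor_step n E T)\<^sup>*\<^sup>* g (override_on g (\<lambda>_. t) F)"
proof -
  have "(recolor_step n E T)\<^sup>*\<^sup>* g (override_on g (\<lambda>_. t) X)" if "X \<subseteq> F" for X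
    using finite_subset[OF that F(1)] that
  proof (induction X rule: finite_induct)
    case (insert x X)
    have proper: "proper_on E T (override_on g (\<lambda>_. t) Y)" if "Y \<subseteq> F" for Y
      using proper_on_override_enlarging_class[OF g t F(2,3) that] .
    have "recolor_step n E T (override_on g (\<lambda>_. t) X) (override_on g (\<lambda>_. t) (insert x X))"
    proof (rule recolor_stepI[where S = "{g x, t}"])
      show "proper_on E T (override_on g (\<lambda>_. t) X)"
        "proper_on E T (override_on g (\<lambda>_. t) (insert x X))"
        using proper insert.prems by auto
      show "card {g x, t} \<le> n"
        using n by (auto simp: card_insert_if)
    qed (auto simp: override_on_def split: if_splits)
    with insert show ?case
      by (auto intro: rtranclp.rtrancl_into_rtrancl)
  qed simp
  then show ?thesis by simp
qed

lemma recolor_steps_add_class: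
  assumes t: "t \<notin> T" and F: "F \<subseteq> E" "matching F"
    and steps: "(recolor_step n (E - F) T)\<^sup>*\<^sup>* f g"
  shows "(recolor_step n E (insert t T))\<^sup>*\<^sup>* (override_on f (\<lambda>_. t) F) (override_on g (\<lambda>_. t) F)"
  using steps
proof (induction rule: rtranclp_induct)
  case (step p q)
  have proper: "proper_on E (insert t T) (override_on h (\<lambda>_. t) F)" if "proper_on (E - F) T h" for h
    using proper_on_override_matching[OF that F(2) t] F(1) by (simp add: Un_absorb2)
  obtain S where "proper_on (E - F) T p" "proper_on (E - F) T q" "finite S" "card S \<le> n"
    "\<And>e. e \<in> E - F \<Longrightarrow> p e \<noteq> q e \<Longrightarrow> p e \<in> S \<and> q e \<in> S"
    using step.hyps(2) unfolding recolor_step_def by blast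
  then have "recolor_step n E (insert t T) (override_on p (\<lambda>_. t) F) (override_on q (\<lambda>_. t) F)"
    by (intro recolor_stepI[where S = S] proper) (auto simp: override_on_def split: if_splits)
  with step.IH show ?case by (auto intro: rtranclp.rtrancl_into_rtrancl)
qed simp

section \<open>Covering the vertices of high degree by a matching\<close>

definition excess :: "nat \<Rightarrow> 'a set set \<Rightarrow> 'a set" where
  "excess k K = {v. k < degree K v}"

lemma excess_subset: "excess k K \<subseteq> \<Union>K"
  unfolding excess_def using degree_eq_0 by fastforce

lemma edges_hitting_once:
  assumes D: "finite D" "card D \<le> 2" and cover: "D \<subseteq> \<Union>K"
  obtains R where "R \<subseteq> K" "finite R" "card R \<le> 2" "\<And>e. e \<in> R \<Longrightarrow> e \<inter> D \<noteq> {}"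
    "\<And>v. v \<in> D \<Longrightarrow> degree R v = 1"
proof (cases "\<exists>e\<in>K. D \<subseteq> e \<and> D \<noteq> {}")
  case True
  then obtain e where e: "e \<in> K" "D \<subseteq> e" "D \<noteq> {}" by blast
  have "edges_at {e} v = {e}" if "v \<in> D" for v
    using that e by (auto simp: edges_at_def)
  with e show ?thesis
    by (intro that[of "{e}"]) (auto simp: degree_def)
next
  case no_common_edge: False
  have "\<forall>v\<in>D. \<exists>e. e \<in> K \<and> v \<in> e"
    using cover by blast
  then obtain edge where edge: "\<And>v. v \<in> D \<Longrightarrow> edge v \<in> K" "\<And>v. v \<in> D \<Longrightarrow> v \<in> edge v"
    by metis
  have not_mem: "v \<notin> edge w" if "v \<in> D" "w \<in> D" "v \<noteq> w" for v w
  proof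
    assume "v \<in> edge w"
    have "{v, w} = D"
      using that D by (intro card_seteq) auto
    then have "D \<subseteq> edge w" "D \<noteq> {}"
      using \<open>v \<in> edge w\<close> edge(2) that by blast+
    then show False
      using no_common_edge edge(1) that(2) by blast
  qed
  have "edges_at (edge ` D) v = {edge v}" if "v \<in> D" for v
    using that edge not_mem by (auto simp: edges_at_def)
  moreover have "card (edge ` D) \<le> 2"
    using D card_image_le le_trans by blast
  moreover have "e \<inter> D \<noteq> {}" if "e \<in> edge ` D" for e
    using that edge(2) by blast
  ultimately show ?thesis
    using edge(1) D(1) by (intro that[of "edge ` D"]) (auto simp: degree_def)
qed

locale degree_colorable =
  fixes E :: "'a set set" and k :: nat
  assumes finite_E: "finite E"
    and card_edge: "\<And>e. e \<in> E \<Longrightarrow> card e = 2"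
    and three_le_k: "3 \<le> k"
    and colorable_nat:
      "\<And>K. K \<subseteq> E \<Longrightarrow> (\<And>v. degree K v \<le> k) \<Longrightarrow> \<exists>f :: 'a set \<Rightarrow> nat. proper_on K {1..k} f"

lemma degree_colorable_subset:
  assumes "degree_colorable E k" "E' \<subseteq> E"
  shows "degree_colorable E' k"
proof -
  interpret degree_colorable E k by fact
  show ?thesis
  proof unfold_locales
    show "finite E'" using assms(2) finite_E by (rule finite_subset)
    show "card e = 2" if "e \<in> E'" for e using that assms(2) card_edge by blast
    show "\<exists>f :: 'a set \<Rightarrow> nat. proper_on K {1..k} f"
      if "K \<subseteq> E'" "\<And>v. degree K v \<le> k" for K
      using colorable_nat[OF subset_trans[OF that(1) assms(2)] that(2)] .
  qed (rule three_le_k)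
qed

context degree_colorable
begin

lemma colorable:
  fixes C :: "'c set"
  assumes "K \<subseteq> E" "\<And>v. degree K v \<le> k" "card C = k"
  obtains f where "proper_on K C f"
proof -
  obtain f :: "'a set \<Rightarrow> nat" where f: "proper_on K {1..k} f"
    using colorable_nat assms(1,2) by blast
  have "finite C"
    using assms(3) three_le_k by (intro card_ge_0_finite) simp
  then obtain h where "bij_betw h {1..k} C"
    using assms(3) finite_same_card_bij[of "{1..k}" C] by auto
  then show thesis
    by (intro that[OF proper_on_comp[OF f, of h]]) (auto simp: bij_betw_def)
qed

lemma finite_subset_E: "K \<subseteq> E \<Longrightarrow> finite K"
  using finite_E finite_subset by blast

lemma finite_Union_E: "finite (\<Union>E)"
  using finite_E card_edge by (metis card.infinite finite_Union zero_neq_numeral)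

lemma finite_excess: "K \<subseteq> E \<Longrightarrow> finite (excess k K)"
  using excess_subset finite_Union_E by (meson Union_mono finite_subset)

text \<open>At a vertex of \<open>R\<close> of degree \<open>k\<close> in \<open>K\<close>, as many colors are missing as there are edges of
  \<open>R\<close>; an edge of \<open>R\<close> has at most one end outside \<open>excess k K\<close>.\<close>

lemma card_missing_colors_after_removal:
  fixes f :: "'a set \<Rightarrow> 'c"
  assumes K: "K \<subseteq> E" and R: "R \<subseteq> K" "card R \<le> 2" "\<And>e. e \<in> R \<Longrightarrow> e \<inter> excess k K \<noteq> {}"
    and f: "proper_on (K - R) C f" and C: "card C = k"
  shows "card (\<Union>v \<in> {v \<in> \<Union>R. degree K v = k}. missing_colors (K - R) C f v) \<le> 2"
proof -
  let ?missing = "missing_colors (K - R) C f"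
  define Z where "Z = {v \<in> \<Union>R. degree K v = k}"
  have finC: "finite C"
    using C three_le_k by (intro card_ge_0_finite) simp
  have finR: "finite R"
    using K R(1) finite_subset_E by blast
  have finZ: "finite Z"
    using K R(1) by (auto simp: Z_def intro: finite_subset[OF _ finite_Union_E])
  have missing: "card (?missing v) = degree R v" if "v \<in> Z" for v
    using that card_missing_colors[OF f finC, of v] degree_Diff[OF finR R(1), of v]
      degree_mono[OF finite_subset_E[OF K] R(1), of v] C by (simp add: Z_def)
  have one_end: "card (e \<inter> Z) \<le> 1" if "e \<in> R" for e
  proof -
    have "e \<inter> Z \<subset> e"
      using R(3)[OF that] by (auto simp: Z_def excess_def)
    moreover have "card e = 2"
      using that R(1) K card_edge by blast
    ultimately show ?thesis
      using psubset_card_mono[of e "e \<inter> Z"] by (force simp: card_ge_0_finite)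
  qed
  have "card (\<Union>v\<in>Z. ?missing v) \<le> (\<Sum>v\<in>Z. degree R v)"
    using card_UN_le[OF finZ, of ?missing] missing by simp
  also have "\<dots> = (\<Sum>e\<in>R. card (e \<inter> Z))"
    using finR finZ by (rule sum_degree_eq)
  also have "\<dots> \<le> card R"
    using sum_bounded_above[of R "\<lambda>e. card (e \<inter> Z)" 1] one_end by simp
  finally show ?thesis using R(2) by (simp add: Z_def)
qed

lemma matching_covering_high_degrees:
  assumes K: "K \<subseteq> E" and deg: "\<And>v. degree K v \<le> Suc k" and excess: "card (excess k K) \<le> 2"
  obtains N where "N \<subseteq> K" "matching N" "\<And>v. k \<le> degree K v \<Longrightarrow> v \<in> \<Union>N"
proof -
  define C where "C = {1..k}"
  have C: "finite C" "card C = k" by (simp_all add: C_def)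
  obtain R where R: "R \<subseteq> K" "finite R" "card R \<le> 2" "\<And>e. e \<in> R \<Longrightarrow> e \<inter> excess k K \<noteq> {}"
    and degR: "\<And>v. v \<in> excess k K \<Longrightarrow> degree R v = 1"
    using edges_hitting_once[OF finite_excess[OF K] excess excess_subset] by blast
  have deg_eq: "degree (K - R) v = k" if "v \<in> excess k K" for v
    using that deg[of v] degR[of v] degree_Diff[OF R(2,1), of v] by (simp add: excess_def)
  have deg_le: "degree (K - R) v \<le> k" for v
    using deg_eq[of v] degree_Diff[OF R(2,1), of v]
    by (cases "v \<in> excess k K") (auto simp: excess_def)
  obtain f where f: "proper_on (K - R) C f"
    using colorable[OF _ deg_le C(2)] K by blast
  define Z where "Z = {v \<in> \<Union>R. degree K v = k}"
  have "card (\<Union>v\<in>Z. missing_colors (K - R) C f v) < card C"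
    using card_missing_colors_after_removal[OF K R(1,3,4) f C(2)] three_le_k C(2)
    by (simp add: Z_def)
  moreover have "finite (\<Union>v\<in>Z. missing_colors (K - R) C f v)"
    using C(1) by (rule rev_finite_subset) (auto simp: missing_colors_def)
  ultimately have "\<not> C \<subseteq> (\<Union>v\<in>Z. missing_colors (K - R) C f v)"
    by (meson card_mono not_le)
  then obtain d where d: "d \<in> C" "\<And>v. v \<in> Z \<Longrightarrow> d \<notin> missing_colors (K - R) C f v" by blast
  show thesis
  proof (rule that)
    show "colored (K - R) f {d} \<subseteq> K" "matching (colored (K - R) f {d})"
      using matching_color_class[OF f] by (auto simp: colored_def)
    fix v assume v: "k \<le> degree K v"
    have "degree (K - R) v = k" if "v \<notin> Z"
      using that v deg_eq[of v] degree_Diff[OF R(2,1), of v] degree_eq_0[of v R]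
      by (cases "v \<in> excess k K") (auto simp: excess_def Z_def)
    then have "d \<notin> missing_colors (K - R) C f v"
      using d(2) missing_colors_eq_empty_iff[OF f C(1), of v] C(2) by (cases "v \<in> Z") auto
    with d(1) show "v \<in> \<Union>(colored (K - R) f {d})"
      by (auto simp: missing_colors_def colored_def edges_at_def)
  qed
qed

section \<open>Matchings close to a color class\<close>

lemma recolor_matching_to_class:
  assumes f: "proper_on E T f" and S: "S \<subseteq> T" "card S = Suc k" "d \<in> S"
    and N: "N \<subseteq> colored E f S" "matching N" and deg: "\<And>v. degree (colored E f S - N) v \<le> k"
  obtains f' where "recolor_step (Suc k) E T f f'" "colored E f' {d} = N"
    "\<And>e. e \<in> colored E f S \<Longrightarrow> f' e \<in> S" "\<And>e. e \<notin> colored E f S \<Longrightarrow> f' e = f e"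
proof -
  let ?H = "colored E f S"
  have finS: "finite S"
    using S(2) by (simp add: card_ge_0_finite)
  have HN: "?H - N \<subseteq> E"
    using colored_subset by blast
  have "card (S - {d}) = k"
    using S(2,3) finS by simp
  then obtain h where h: "proper_on (?H - N) (S - {d}) h"
    using colorable[OF HN deg] by blast
  define h' where "h' = override_on h (\<lambda>_. d) N"
  have h': "proper_on ?H S h'"
    using proper_on_override_matching[OF h N(2), of d] N(1) S(3)
    by (simp add: h'_def Un_absorb2 insert_absorb)
  have class_d: "h' e = d \<longleftrightarrow> e \<in> N" if "e \<in> ?H" for e
    using that proper_on_color[OF h, of e] by (auto simp: h'_def override_on_def)
  show thesis
  proof (rule that[of "override_on f h' ?H"])
    show "recolor_step (Suc k) E T f (override_on f h' ?H)"
      using recolor_step_override_colored[OF f S(1) h' finS] S(2) by simp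
    show "colored E (override_on f h' ?H) {d} = N"
      using class_d N(1) S(3) by (auto simp: override_on_def colored_def split: if_splits)
  qed (use proper_on_color[OF h'] in auto)
qed

definition surplus :: "('a set \<Rightarrow> 'c) \<Rightarrow> 'c set \<Rightarrow> 'a set set \<Rightarrow> 'a set" where
  "surplus f S F = excess k (colored E f S - F)"

definition near_class ::
  "'c set \<Rightarrow> 'c \<Rightarrow> ('a set \<Rightarrow> 'c) \<Rightarrow> 'c set \<Rightarrow> 'a set set \<Rightarrow> bool" where
  "near_class T t f S F \<longleftrightarrow> proper_on E T f \<and> S \<subseteq> T \<and> card S = Suc k \<and> t \<in> S \<and>
     F \<subseteq> colored E f S \<and> matching F \<and> card (surplus f S F) \<le> 2"

lemma finite_colored: "finite (colored E f S)"
  by (rule finite_subset_E[OF colored_subset])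

lemma finite_surplus: "finite (surplus f S F)"
  unfolding surplus_def by (rule finite_excess) (auto simp: colored_def)

lemma near_class_finite_colors: "near_class T t f S F \<Longrightarrow> finite S"
  unfolding near_class_def by (simp add: card_ge_0_finite)

lemma near_class_subset_E: "near_class T t f S F \<Longrightarrow> F \<subseteq> E"
  unfolding near_class_def using colored_subset by blast

lemma near_class_degree_le:
  assumes "near_class T t f S F"
  shows "degree (colored E f S) v \<le> Suc k"
  using assms degree_le_card_colors[OF proper_on_colored near_class_finite_colors[OF assms]]
  unfolding near_class_def by metis

lemma surplus_not_covered:
  assumes near: "near_class T t f S F" and x: "x \<in> surplus f S F"
  shows "x \<notin> \<Union>F"
proof
  assume "x \<in> \<Union>F"
  then have "degree (colored E f S - F) x < degree (colored E f S) x"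
    using near finite_colored unfolding near_class_def by (intro degree_Diff_less) auto
  with near_class_degree_le[OF near, of x] x show False
    by (simp add: surplus_def excess_def)
qed

lemma surplus_no_missing_color:
  assumes near: "near_class T t f S F" and x: "x \<in> surplus f S F"
  shows "S \<subseteq> f ` edges_at E x"
proof -
  have f: "proper_on (colored E f S) S f" and S: "card S = Suc k"
    using near proper_on_colored unfolding near_class_def by blast+
  have "degree (colored E f S) x = card S"
    using near_class_degree_le[OF near, of x] x S
      degree_mono[OF finite_colored Diff_subset, of f S F x]
    by (simp add: surplus_def excess_def)
  then have "missing_colors (colored E f S) S f x = {}"
    using missing_colors_eq_empty_iff[OF f near_class_finite_colors[OF near]] by blast
  then show ?thesis
    by (auto simp: missing_colors_def edges_at_def colored_def)
qed

lemma matching_covering_surplus: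
  assumes near: "near_class T t f S F"
  obtains N where "N \<subseteq> colored E f S - F" "matching N"
    "\<forall>v. degree (colored E f S - F - N) v \<le> k"
    "\<forall>v \<in> - surplus f S F. degree (colored E f S - F - N) v < k"
    "\<forall>v. degree (colored E f S - N) v \<le> k"
proof -
  let ?H = "colored E f S" and ?K = "colored E f S - F"
  have K: "?K \<subseteq> E"
    using colored_subset by blast
  have degK: "degree ?K v \<le> Suc k" for v
    using near_class_degree_le[OF near, of v] degree_mono[OF finite_colored Diff_subset, of f S F v]
    by simp
  obtain N where N: "N \<subseteq> ?K" "matching N" and cover: "\<And>v. k \<le> degree ?K v \<Longrightarrow> v \<in> \<Union>N"
    using matching_covering_high_degrees[OF K degK] near
    unfolding near_class_def surplus_def by blast
  have less: "degree (?K - N) v < degree ?K v" if "k \<le> degree ?K v" for v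
    using degree_Diff_less[OF finite_subset_E[OF K] N(1) cover[OF that]] .
  have degKN: "degree (?K - N) v \<le> k" for v
    using less[of v] degK[of v] degree_mono[OF finite_subset_E[OF K] Diff_subset, of N v]
    by (cases "k \<le> degree ?K v") auto
  have off_surplus: "degree (?K - N) v < k" if "v \<notin> surplus f S F" for v
    using that less[of v] degree_mono[OF finite_subset_E[OF K] Diff_subset, of N v]
    by (cases "k \<le> degree ?K v") (auto simp: surplus_def excess_def)
  have "degree (?H - N) v \<le> k" for v
  proof -
    have "degree (?H - N) v \<le> degree (?K - N) v + degree F v"
      using finite_subset_E[OF near_class_subset_E[OF near]]
      by (intro degree_subset_Un_le) (auto simp: finite_colored)
    moreover have "degree F v \<le> 1"
      using near by (intro matching_degree_le) (simp add: near_class_def)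
    moreover have "degree F v = 0" if "v \<in> surplus f S F"
      using surplus_not_covered[OF near that] by (rule degree_eq_0)
    ultimately show ?thesis
      using degKN[of v] off_surplus[of v] by (cases "v \<in> surplus f S F") auto
  qed
  then show thesis
    using that[OF N] degKN off_surplus by simp
qed

lemma recolor_swapping_color:
  assumes f: "proper_on E T f" and S: "S \<subseteq> T" "card S = Suc k" "t \<in> S" and c: "c \<in> T" "c \<notin> S"
    and N: "N \<subseteq> colored E f S" "matching N" and deg: "\<And>v. degree (colored E f S - N) v \<le> k"
  obtains f' S' where "recolor_step (Suc k) E T f f'" "S' \<subseteq> T" "card S' = Suc k" "t \<in> S'" "c \<in> S'"
    "colored E f' S' = (colored E f S - N) \<union> colored E f {c}" "\<forall>e. f e = c \<longrightarrow> f' e = c"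
proof -
  let ?H = "colored E f S"
  have finS: "finite S"
    using S(2) by (simp add: card_ge_0_finite)
  have "card (S - {t}) \<noteq> 0"
    using S(2,3) finS three_le_k by simp
  then have "S - {t} \<noteq> {}" by force
  then obtain d where d: "d \<in> S" "d \<noteq> t" by blast
  obtain f' where step: "recolor_step (Suc k) E T f f'" and class_d: "colored E f' {d} = N"
    and f'_in: "\<And>e. e \<in> ?H \<Longrightarrow> f' e \<in> S" and f'_out: "\<And>e. e \<notin> ?H \<Longrightarrow> f' e = f e"
    using recolor_matching_to_class[OF f S(1,2) d(1) N deg] by blast
  define S' where "S' = insert c (S - {d})"
  have "e \<in> colored E f' S' \<longleftrightarrow> e \<in> (?H - N) \<union> colored E f {c}" if "e \<in> E" for e
    using that c(2) class_d f'_in[of e] f'_out[of e] unfolding S'_def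
    by (cases "e \<in> ?H") (auto simp: colored_def)
  then have "colored E f' S' = (?H - N) \<union> colored E f {c}"
    by (auto simp: colored_def)
  moreover have "card S' = Suc k"
    using S(2) finS d(1) c(2) three_le_k by (simp add: S'_def)
  moreover have "S' \<subseteq> T" "t \<in> S'" "c \<in> S'"
    using S c d by (auto simp: S'_def)
  moreover have "\<forall>e. f e = c \<longrightarrow> f' e = c"
    using c(2) f'_out by (auto simp: colored_def)
  ultimately show thesis
    using step by (intro that[of f' S'])
qed

lemma surplus_swapped_color:
  assumes f: "proper_on E T f"
    and H': "colored E f' S' = (colored E f S - N) \<union> colored E f {c}"
    and degKN: "\<forall>v. degree (colored E f S - F - N) v \<le> k"
    and off_surplus: "\<forall>v \<in> - surplus f S F. degree (colored E f S - F - N) v < k"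
  shows "surplus f' S' F \<subseteq> surplus f S F" "c \<notin> f ` edges_at E x \<Longrightarrow> x \<notin> surplus f' S' F"
proof -
  have degree_le: "degree (colored E f' S' - F) v
      \<le> degree (colored E f S - F - N) v + degree (colored E f {c}) v" for v
    unfolding H' by (intro degree_subset_Un_le) (auto simp: finite_colored)
  show "surplus f' S' F \<subseteq> surplus f S F"
  proof (rule subsetI, rule ccontr)
    fix v assume v: "v \<in> surplus f' S' F" "v \<notin> surplus f S F"
    have "degree (colored E f {c}) v \<le> 1"
      using matching_color_class[OF f] by (rule matching_degree_le)
    moreover have "degree (colored E f S - F - N) v < k"
      using off_surplus v(2) by simp
    ultimately show False
      using degree_le[of v] v(1) by (simp add: surplus_def excess_def)
  qed
  show "x \<notin> surplus f' S' F" if "c \<notin> f ` edges_at E x"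
  proof -
    have "degree (colored E f {c}) x = 0"
      using that by (intro degree_eq_0) (auto simp: colored_def edges_at_def)
    then show ?thesis
      using degree_le[of x] spec[OF degKN, of x] by (simp add: surplus_def excess_def)
  qed
qed

lemma near_class_switch_color:
  assumes near: "near_class T t f S F" and c: "c \<in> T" "c \<notin> S"
  obtains f' S' where "recolor_step (Suc k) E T f f'" "near_class T t f' S' F" "c \<in> S'"
    "\<forall>e. f e = c \<longrightarrow> f' e = c" "surplus f' S' F \<subseteq> surplus f S F"
    "\<forall>x. c \<notin> f ` edges_at E x \<longrightarrow> x \<notin> surplus f' S' F"
proof -
  let ?H = "colored E f S" and ?K = "colored E f S - F" and ?Ec = "colored E f {c}"
  have f: "proper_on E T f" and S: "S \<subseteq> T" "card S = Suc k" "t \<in> S" and F: "F \<subseteq> ?H" "matching F"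
    and card_surplus: "card (surplus f S F) \<le> 2"
    using near unfolding near_class_def by auto
  obtain N where N: "N \<subseteq> ?K" "matching N"
    and degKN: "\<forall>v. degree (?K - N) v \<le> k"
    and off_surplus: "\<forall>v \<in> - surplus f S F. degree (?K - N) v < k"
    and deg: "\<forall>v. degree (?H - N) v \<le> k"
    by (rule matching_covering_surplus[OF near])
  have "N \<subseteq> ?H"
    using N(1) by blast
  then obtain f' S' where step: "recolor_step (Suc k) E T f f'"
    and S': "S' \<subseteq> T" "card S' = Suc k" "t \<in> S'" "c \<in> S'"
    and H': "colored E f' S' = (?H - N) \<union> ?Ec" and class_c: "\<forall>e. f e = c \<longrightarrow> f' e = c"
    using recolor_swapping_color[OF f S c _ N(2)] deg by blast
  note surplus' = surplus_swapped_color[OF f H' degKN off_surplus]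
  have "card (surplus f' S' F) \<le> 2"
    using card_mono[OF finite_surplus surplus'(1)] card_surplus by simp
  moreover have "proper_on E T f'"
    using step unfolding recolor_step_def by blast
  moreover have "F \<subseteq> colored E f' S'"
    using F(1) N(1) unfolding H' by blast
  ultimately have "near_class T t f' S' F"
    using S' F(2) by (simp add: near_class_def)
  then show thesis
    using step S'(4) class_c surplus' by (intro that[of f' S']) auto
qed

end

section \<open>Exchanging edges\<close>

definition exchange :: "'a set \<Rightarrow> 'a set set \<Rightarrow> 'a set set" where
  "exchange e F = insert e {e' \<in> F. e' \<inter> e = {}}"

definition far_ends :: "'a set set \<Rightarrow> 'a set \<Rightarrow> 'a set" where
  "far_ends F e = \<Union>{e' \<in> F. e' \<inter> e \<noteq> {}} - e"

lemma matching_exchange: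
  assumes "matching F"
  shows "matching (exchange e F)"
  using assms unfolding matching_def exchange_def pairwise_insert
  by (auto simp: disjnt_def intro: pairwise_mono)

lemma card_far_ends_le:
  assumes F: "matching F" "\<And>e'. e' \<in> F \<Longrightarrow> card e' = 2" and e: "finite e"
  shows "finite (far_ends F e)" "card (far_ends F e) \<le> card (e \<inter> \<Union>F)"
proof -
  have ends: "finite (\<Union>(edges_at F v) - {v})" "card (\<Union>(edges_at F v) - {v}) = 1"
    if v: "v \<in> e \<inter> \<Union>F" for v
  proof -
    obtain e' where e': "e' \<in> F" "v \<in> e'"
      using v by blast
    then show "finite (\<Union>(edges_at F v) - {v})" "card (\<Union>(edges_at F v) - {v}) = 1"
      using F(2)[OF e'(1)] matching_edges_at[OF F(1) e'] by (simp_all add: card_ge_0_finite)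
  qed
  have subset: "far_ends F e \<subseteq> (\<Union>v \<in> e \<inter> \<Union>F. \<Union>(edges_at F v) - {v})"
    by (auto simp: far_ends_def edges_at_def)
  have fin: "finite (\<Union>v \<in> e \<inter> \<Union>F. \<Union>(edges_at F v) - {v})"
    using e ends(1) by (intro finite_UN_I) auto
  show "finite (far_ends F e)"
    using subset fin by (rule finite_subset)
  have "card (far_ends F e) \<le> card (\<Union>v \<in> e \<inter> \<Union>F. \<Union>(edges_at F v) - {v})"
    using fin subset by (rule card_mono)
  also have "\<dots> \<le> (\<Sum>v \<in> e \<inter> \<Union>F. card (\<Union>(edges_at F v) - {v}))"
    using e by (intro card_UN_le) simp
  also have "\<dots> = card (e \<inter> \<Union>F)"
    using ends(2) by simp
  finally show "card (far_ends F e) \<le> card (e \<inter> \<Union>F)" .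
qed

lemma excess_Diff_exchange:
  assumes H: "finite H" "\<And>v. degree H v \<le> Suc k" and F: "F \<subseteq> H" and e: "e \<in> H"
  shows "excess k (H - exchange e F) \<subseteq> (excess k (H - F) - e) \<union> far_ends F e"
proof
  fix v assume v: "v \<in> excess k (H - exchange e F)"
  have "v \<notin> e"
  proof
    assume "v \<in> e"
    then have "degree (H - exchange e F) v < degree H v"
      using H(1) F e by (intro degree_Diff_less) (auto simp: exchange_def)
    with H(2)[of v] v show False
      by (simp add: excess_def)
  qed
  moreover have "v \<in> excess k (H - F)" if "v \<notin> far_ends F e"
  proof -
    have "edges_at (H - exchange e F) v = edges_at (H - F) v"
      using that \<open>v \<notin> e\<close> by (auto simp: edges_at_def exchange_def far_ends_def)
    with v show ?thesis
      by (simp add: excess_def degree_def)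
  qed
  ultimately show "v \<in> (excess k (H - F) - e) \<union> far_ends F e" by blast
qed

lemma Diff_exchange_subset:
  assumes M: "matching M" "e \<in> M"
  shows "M - exchange e F \<subseteq> M - F - {e}"
proof
  fix m assume m: "m \<in> M - exchange e F"
  moreover have "m \<notin> F"
  proof
    assume "m \<in> F"
    then obtain v where "v \<in> m" "v \<in> e"
      using m by (auto simp: exchange_def)
    then have "m = e"
      using matchingD[OF M(1)] M(2) m by blast
    then show False
      using m by (simp add: exchange_def)
  qed
  ultimately show "m \<in> M - F - {e}"
    by (auto simp: exchange_def)
qed

context degree_colorable
begin

lemma card_surplus_exchange_le:
  assumes near: "near_class T t f S F" and e: "e \<in> colored E f S"
    and surplus_e: "surplus f S F = {} \<or> surplus f S F \<inter> e \<noteq> {}"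
  shows "card (surplus f S (exchange e F)) \<le> 2"
proof -
  have F: "F \<subseteq> colored E f S" "matching F" and card_surplus: "card (surplus f S F) \<le> 2"
    using near unfolding near_class_def by auto
  have card_e: "card e = 2"
    using e card_edge colored_subset by blast
  then have fin_e: "finite e"
    by (simp add: card_ge_0_finite)
  have "card e' = 2" if "e' \<in> F" for e'
    using that near_class_subset_E[OF near] card_edge by blast
  note far_ends = card_far_ends_le[OF F(2) this fin_e]
  have "finite ((surplus f S F - e) \<union> far_ends F e)"
    using finite_surplus[of f S F] far_ends(1) by simp
  moreover have "surplus f S (exchange e F) \<subseteq> (surplus f S F - e) \<union> far_ends F e"
    unfolding surplus_def
    using finite_colored near_class_degree_le[OF near] F(1) e by (rule excess_Diff_exchange)
  ultimately have "card (surplus f S (exchange e F)) \<le> card ((surplus f S F - e) \<union> far_ends F e)"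
    by (rule card_mono)
  also have "\<dots> \<le> card (surplus f S F - e) + card (far_ends F e)"
    by (rule card_Un_le)
  also have "\<dots> \<le> card (surplus f S F - e) + card (e \<inter> \<Union>F)"
    using far_ends(2) by simp
  also have "\<dots> \<le> 2"
  proof (cases "surplus f S F = {}")
    case True
    then show ?thesis
      using card_mono[OF fin_e Int_lower1, of "\<Union>F"] card_e by simp
  next
    case False
    then obtain u where u: "u \<in> surplus f S F" "u \<in> e"
      using surplus_e by blast
    have "card (surplus f S F - e) < card (surplus f S F)"
      using u by (intro psubset_card_mono finite_surplus) blast
    moreover have "card (e \<inter> \<Union>F) < card e"
      using u surplus_not_covered[OF near] by (intro psubset_card_mono fin_e) blast
    ultimately show ?thesis
      using card_surplus card_e by simp
  qed
  finally show ?thesis .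
qed

lemma near_class_exchange:
  assumes near: "near_class T t f S F" and e: "e \<in> colored E f S"
    and surplus_e: "surplus f S F = {} \<or> surplus f S F \<inter> e \<noteq> {}"
  shows "near_class T t f S (exchange e F)"
proof -
  have F: "F \<subseteq> colored E f S" "matching F"
    using near unfolding near_class_def by auto
  have "exchange e F \<subseteq> colored E f S"
    using F(1) e by (auto simp: exchange_def)
  then show ?thesis
    using near matching_exchange[OF F(2)] card_surplus_exchange_le[OF near e surplus_e]
    by (simp add: near_class_def)
qed

text \<open>An exchange may enlarge the surplus from \<open>0\<close> to \<open>2\<close> vertices, hence the factor \<open>3\<close>.\<close>

definition potential :: "'a set set \<Rightarrow> ('a set \<Rightarrow> 'c) \<Rightarrow> 'c set \<Rightarrow> 'a set set \<Rightarrow> nat" where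
  "potential M f S F = 3 * card (M - F) + card (surplus f S F)"

lemma potential_exchange_less:
  assumes near: "near_class T t f' S' (exchange e F)"
    and M: "matching M" "finite M" and e: "e \<in> M - F"
  shows "potential M f' S' (exchange e F) < potential M f S F"
proof -
  have "M - exchange e F \<subseteq> M - F - {e}"
    using M(1) e by (intro Diff_exchange_subset) auto
  then have "card (M - exchange e F) < card (M - F)"
    using M(2) e by (intro psubset_card_mono) auto
  moreover have "card (surplus f' S' (exchange e F)) \<le> 2"
    using near unfolding near_class_def by blast
  ultimately show ?thesis
    by (simp add: potential_def)
qed

lemma potential_less_if_surplus_psubset:
  "surplus f' S' F \<subset> surplus f S F \<Longrightarrow> potential M f' S' F < potential M f S F"
  by (simp add: potential_def psubset_card_mono finite_surplus)

lemma near_class_reach_edge_color: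
  assumes near: "near_class T t f S F" and e: "e \<in> E"
  obtains f' S' where "(recolor_step (Suc k) E T)\<^sup>*\<^sup>* f f'" "near_class T t f' S' F"
    "e \<in> colored E f' S'" "surplus f' S' F \<subseteq> surplus f S F"
proof (cases "f e \<in> S")
  case True
  then show thesis
    using that[of f S] near e by (simp add: colored_def)
next
  case False
  have "f e \<in> T"
    using near e proper_on_color unfolding near_class_def by metis
  then obtain f' S' where "recolor_step (Suc k) E T f f'" "near_class T t f' S' F" "f e \<in> S'"
    "\<forall>e'. f e' = f e \<longrightarrow> f' e' = f e" "surplus f' S' F \<subseteq> surplus f S F"
    using near_class_switch_color[OF near _ False] by metis
  then show thesis
    using that[of f' S'] e by (simp add: colored_def r_into_rtranclp)
qed

lemma near_class_progress_at_edge: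
  assumes near: "near_class T t f S F" and M: "matching M" "M \<subseteq> E" and e: "e \<in> M - F"
    and surplus_e: "surplus f S F = {} \<or> surplus f S F \<inter> e \<noteq> {}"
  obtains f' S' F' where "(recolor_step (Suc k) E T)\<^sup>*\<^sup>* f f'" "near_class T t f' S' F'"
    "potential M f' S' F' < potential M f S F"
proof -
  obtain f' S' where steps: "(recolor_step (Suc k) E T)\<^sup>*\<^sup>* f f'"
    and near': "near_class T t f' S' F"
    and e': "e \<in> colored E f' S'" and subset: "surplus f' S' F \<subseteq> surplus f S F"
    using near_class_reach_edge_color[OF near, of e] M(2) e by blast
  show thesis
  proof (cases "surplus f' S' F = {} \<or> surplus f' S' F \<inter> e \<noteq> {}")
    case True
    then have near'': "near_class T t f' S' (exchange e F)"
      using near_class_exchange[OF near' e'] by blast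
    then show thesis
      using that[OF steps near''] potential_exchange_less[OF near'' M(1) finite_subset_E[OF M(2)] e]
      by blast
  next
    case False
    then have "surplus f' S' F \<subset> surplus f S F"
      using subset surplus_e by blast
    then show thesis
      by (intro that[OF steps near'] potential_less_if_surplus_psubset)
  qed
qed

lemma near_class_progress_at_vertex:
  assumes near: "near_class T t f S F" and T: "finite T"
    and x: "x \<in> surplus f S F" "degree E x < card T"
  obtains f' S' where "recolor_step (Suc k) E T f f'" "near_class T t f' S' F"
    "surplus f' S' F \<subset> surplus f S F"
proof -
  have "proper_on E T f"
    using near unfolding near_class_def by blast
  then have "missing_colors E T f x \<noteq> {}"
    using missing_colors_eq_empty_iff[OF _ T] x(2) by force
  then obtain c where c: "c \<in> T" "c \<notin> f ` edges_at E x"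
    by (auto simp: missing_colors_def)
  then have "c \<notin> S"
    using surplus_no_missing_color[OF near x(1)] by blast
  then obtain f' S' where "recolor_step (Suc k) E T f f'" "near_class T t f' S' F"
    "surplus f' S' F \<subseteq> surplus f S F" "\<forall>x. c \<notin> f ` edges_at E x \<longrightarrow> x \<notin> surplus f' S' F"
    using near_class_switch_color[OF near c(1)] by metis
  with c(2) x(1) show thesis
    by (intro that[of f' S']) auto
qed

lemma near_class_progress:
  assumes near: "near_class T t f S F" and T: "finite T" and M: "matching M" "M \<subseteq> E"
    and cover: "\<And>x. x \<notin> \<Union>M \<Longrightarrow> degree E x < card T"
    and unfinished: "\<not> M \<subseteq> F \<or> surplus f S F \<noteq> {}"
  obtains f' S' F' where "(recolor_step (Suc k) E T)\<^sup>*\<^sup>* f f'" "near_class T t f' S' F'"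
    "potential M f' S' F' < potential M f S F"
proof (cases "surplus f S F = {}")
  case True
  then obtain e where "e \<in> M - F"
    using unfinished by blast
  then show thesis
    by (rule near_class_progress_at_edge[OF near M]) (use True that in blast)+
next
  case False
  then obtain x where x: "x \<in> surplus f S F" by blast
  show thesis
  proof (cases "x \<in> \<Union>M")
    case True
    then obtain e where e: "e \<in> M - F" "x \<in> e"
      using surplus_not_covered[OF near x] by blast
    show thesis
      using e(1) by (rule near_class_progress_at_edge[OF near M]) (use x e(2) that in blast)+
  next
    case False
    then obtain f' S' where step: "recolor_step (Suc k) E T f f'"
      and near': "near_class T t f' S' F"
      and less: "surplus f' S' F \<subset> surplus f S F"
      using near_class_progress_at_vertex[OF near T x cover] by blast
    have "(recolor_step (Suc k) E T)\<^sup>*\<^sup>* f f'"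
      using step by blast
    then show thesis
      using near' potential_less_if_surplus_psubset[OF less] by (rule that)
  qed
qed

lemma near_class_without_surplus:
  assumes near: "near_class T t f S F" and surplus: "surplus f S F = {}"
  obtains f' where "recolor_step (Suc k) E T f f'" "colored E f' {t} = F"
proof -
  have "degree (colored E f S - F) v \<le> k" for v
    using surplus by (auto simp: surplus_def excess_def not_less)
  then show thesis
    using near that unfolding near_class_def
    by (auto intro: recolor_matching_to_class[of T f S t F])
qed

lemma near_class_reach_matching:
  assumes "near_class T t f S F" and T: "finite T" and M: "matching M" "M \<subseteq> E"
    and cover: "\<And>x. x \<notin> \<Union>M \<Longrightarrow> degree E x < card T"
  obtains f' where "(recolor_step (Suc k) E T)\<^sup>*\<^sup>* f f'" "M \<subseteq> colored E f' {t}"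
  using assms(1)
proof (induction "potential M f S F" arbitrary: f S F thesis rule: less_induct)
  case less
  show ?case
  proof (cases "\<not> M \<subseteq> F \<or> surplus f S F \<noteq> {}")
    case True
    obtain f' S' F' where steps: "(recolor_step (Suc k) E T)\<^sup>*\<^sup>* f f'"
      and near': "near_class T t f' S' F'" and "potential M f' S' F' < potential M f S F"
      using near_class_progress[OF less.prems(2) T M cover True] .
    then obtain f'' where "(recolor_step (Suc k) E T)\<^sup>*\<^sup>* f' f''" "M \<subseteq> colored E f'' {t}"
      using less.hyps by blast
    then show ?thesis
      using less.prems(1) steps by (meson rtranclp_trans)
  next
    case False
    then obtain f' where "recolor_step (Suc k) E T f f'" "colored E f' {t} = F"
      using near_class_without_surplus[OF less.prems(2)] by blast
    with False show ?thesis
      by (intro less.prems(1)[of f']) auto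
  qed
qed

lemma near_class_color_class:
  assumes f: "proper_on E T f" and S: "S \<subseteq> T" "card S = Suc k" "t \<in> S"
  shows "near_class T t f S (colored E f {t})"
proof -
  have finS: "finite S"
    using S(2) by (simp add: card_ge_0_finite)
  have "colored E f S - colored E f {t} = colored E f (S - {t})"
    by (auto simp: colored_def)
  moreover have "degree (colored E f (S - {t})) v \<le> k" for v
    using degree_le_card_colors[OF proper_on_colored[OF f], of "S - {t}" v] finS S by simp
  ultimately have "surplus f S (colored E f {t}) = {}"
    by (auto simp: surplus_def excess_def not_less)
  then show ?thesis
    unfolding near_class_def using f S matching_color_class[OF f] by (auto simp: colored_def)
qed

lemma recolor_steps_to_superset_class:
  assumes T: "finite T" "k < card T" "t \<in> T" and f: "proper_on E T f" and M: "matching M" "M \<subseteq> E"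
    and cover: "\<And>x. x \<notin> \<Union>M \<Longrightarrow> degree E x < card T"
  obtains f' where "(recolor_step (Suc k) E T)\<^sup>*\<^sup>* f f'" "M \<subseteq> colored E f' {t}"
proof -
  obtain S where "{t} \<subseteq> S" "S \<subseteq> T" "card S = Suc k"
    using exists_subset_between[of "{t}" "Suc k" T] T by auto
  then have "near_class T t f S (colored E f {t})"
    using near_class_color_class[OF f] by blast
  then show thesis
    using near_class_reach_matching[OF _ T(1) M cover] that by blast
qed

end

section \<open>Connecting two colorings\<close>

lemma degree_less_off_color_class:
  assumes g: "proper_on E T g" and T: "finite T" "t \<in> T" and v: "v \<notin> \<Union>(colored E g {t})"
  shows "degree E v < card T"
proof -
  have "t \<in> missing_colors E T g v"
    using T(2) v by (auto simp: missing_colors_def colored_def edges_at_def)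
  then show ?thesis
    using missing_colors_eq_empty_iff[OF g T(1), of v] degree_le_card_colors[OF g T(1), of v]
    by force
qed

lemma recolor_steps_via_common_class:
  assumes n: "2 \<le> n" and E: "finite E" and t: "t \<notin> T"
    and f: "proper_on E (insert t T) f" and g: "proper_on E (insert t T) g"
    and class_g: "colored E g {t} \<subseteq> colored E f {t}"
    and connected: "\<And>p q. proper_on (E - colored E f {t}) T p \<Longrightarrow>
      proper_on (E - colored E f {t}) T q \<Longrightarrow>
      (recolor_step n (E - colored E f {t}) T)\<^sup>*\<^sup>* p q"
  shows "(recolor_step n E (insert t T))\<^sup>*\<^sup>* f g"
proof -
  let ?F = "colored E f {t}"
  have F: "?F \<subseteq> E" "finite ?F" "matching ?F"
    using E matching_color_class[OF f] by (simp_all add: colored_def)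
  have proper: "proper_on (E - ?F) T h" if "proper_on E (insert t T) h" "colored E h {t} \<subseteq> ?F" for h
    using that(1)
  proof (rule proper_on_subset)
    show "h ` (E - ?F) \<subseteq> T"
      using proper_on_color[OF that(1)] that(2) by (auto simp: colored_def)
  qed blast
  have "(recolor_step n E (insert t T))\<^sup>*\<^sup>* (override_on f (\<lambda>_. t) ?F) (override_on g (\<lambda>_. t) ?F)"
    by (intro recolor_steps_add_class t F connected proper f g class_g order_refl)
  moreover have "override_on f (\<lambda>_. t) ?F = f"
    by (auto simp: override_on_def colored_def)
  moreover have "(recolor_step n E (insert t T))\<^sup>*\<^sup>* g (override_on g (\<lambda>_. t) ?F)"
    using recolor_steps_enlarge_class[OF n g _ F(2,3) class_g] by blast
  ultimately show ?thesis
    using sympD[OF symp_rtranclp[OF symp_recolor_step]] by (metis rtranclp_trans)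
qed

theorem recolor_steps_connected:
  assumes "finite T" "degree_colorable E k" "proper_on E T f" "proper_on E T g"
  shows "(recolor_step (Suc k) E T)\<^sup>*\<^sup>* f g"
  using assms
proof (induction T arbitrary: E f g rule: finite_induct)
  case empty
  then have "recolor_step (Suc k) E {} f g"
    by (intro recolor_stepI[where S = "{}"]) (auto dest: proper_on_color)
  then show ?case by blast
next
  case (insert t T)
  interpret degree_colorable E k by fact
  let ?T = "insert t T"
  have T: "finite ?T" "t \<in> ?T"
    using insert.hyps by simp_all
  show ?case
  proof (cases "card ?T \<le> Suc k")
    case True
    then have "recolor_step (Suc k) E ?T f g"
      using insert.prems(2,3) T by (intro recolor_stepI[where S = ?T]) (auto dest: proper_on_color)
    then show ?thesis by blast
  next
    case False
    then have "k < card ?T" by simp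
    then obtain f' where steps: "(recolor_step (Suc k) E ?T)\<^sup>*\<^sup>* f f'"
      and class_g: "colored E g {t} \<subseteq> colored E f' {t}"
      using recolor_steps_to_superset_class[OF T(1) _ T(2) insert.prems(2)
          matching_color_class[OF insert.prems(3)] colored_subset
          degree_less_off_color_class[OF insert.prems(3) T]] by blast
    have f': "proper_on E ?T f'"
      using steps insert.prems(2) by (rule recolor_steps_proper_on)
    have "(recolor_step (Suc k) E ?T)\<^sup>*\<^sup>* f' g"
      using three_le_k
      by (intro recolor_steps_via_common_class finite_E insert.hyps(2) f' insert.prems(3) class_g
          insert.IH degree_colorable_subset[OF insert.prems(1)]) auto
    with steps show ?thesis by (rule rtranclp_trans)
  qed
qed

lemma proper_coloring_iff:
  "proper_coloring G t f \<longleftrightarrow> f \<in> extensional (edges G) \<and> proper_on (edges G) {1..t} f"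
  unfolding proper_coloring_def proper_on_def PiE_def adjacent_edges_def inj_on_def edges_at_def
  by blast

lemma proper_coloring_restrict:
  "proper_on (edges G) {1..t} f \<Longrightarrow> proper_coloring G t (restrict f (edges G))"
  by (auto simp: proper_coloring_iff proper_on_def inj_on_def edges_at_def)

lemma recolor_step_differ_by_at_most:
  assumes "recolor_step n (edges G) {1..t} f g"
  shows "differ_by_at_most G t n (restrict f (edges G)) (restrict g (edges G))"
proof -
  obtain S where S: "finite S" "card S \<le> n" "\<forall>e\<in>edges G. f e \<noteq> g e \<longrightarrow> f e \<in> S \<and> g e \<in> S"
    using assms unfolding recolor_step_def by blast
  have "{j \<in> {1..t}. color_class G (restrict f (edges G)) j
      \<noteq> color_class G (restrict g (edges G)) j} \<subseteq> S"
    using S(3) by (force simp: color_class_def)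
  then show ?thesis
    unfolding differ_by_at_most_def using S(2) by (rule order_trans[OF card_mono[OF S(1)]])
qed

lemma recolor_steps_n_equivalent:
  assumes steps: "(recolor_step n (edges G) {1..t})\<^sup>*\<^sup>* f g" and f: "proper_on (edges G) {1..t} f"
  shows "n_equivalent G t n (restrict f (edges G)) (restrict g (edges G))"
proof -
  have "recolor_step n (edges G) {1..t} g g"
    using recolor_steps_proper_on[OF steps f] by (rule recolor_step_refl)
  with steps have "(recolor_step n (edges G) {1..t})\<^sup>+\<^sup>+ f g"
    by (metis rtranclp_into_tranclp1)
  then obtain l h where l: "0 < l" and h: "h 0 = f" "h l = g"
    and step: "\<And>i. i < l \<Longrightarrow> recolor_step n (edges G) {1..t} (h i) (h (Suc i))"
    unfolding tranclp_power relpowp_fun_conv by blast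
  have "proper_on (edges G) {1..t} (h i)" if "i \<le> l" for i
    using that step[of i] recolor_steps_proper_on[OF steps f] h(2)
    by (cases "i = l") (auto simp: recolor_step_def)
  then show ?thesis
    unfolding n_equivalent_def using l h step
    by (intro exI[of _ l] exI[of _ "\<lambda>i. restrict (h i) (edges G)"])
      (auto intro: proper_coloring_restrict recolor_step_differ_by_at_most)
qed

section \<open>Line perfect graphs\<close>

lemma intersecting_edges_star_or_triangle:
  assumes K: "\<forall>e\<in>K. card e = 2" and meet: "\<forall>e\<in>K. \<forall>e'\<in>K. e \<inter> e' \<noteq> {}"
  shows "(\<exists>v. \<forall>e\<in>K. v \<in> e) \<or> (\<exists>u v w. K \<subseteq> {{u, v}, {v, w}, {u, w}})"
proof (cases "\<exists>v. \<forall>e\<in>K. v \<in> e")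
  case no_center: False
  note card2 = bspec[OF K] and intersect = bspec[OF bspec[OF meet]]
  have edge_eq: "e = {a, b}" if "e \<in> K" "a \<in> e" "b \<in> e" "a \<noteq> b" for e a b
    using card2[OF that(1)] that(2-4) by (auto simp: card_2_iff)
  obtain e where e: "e \<in> K"
    using no_center by blast
  obtain u v where uv: "e = {u, v}" "u \<noteq> v"
    using card2[OF e] by (auto simp: card_2_iff)
  obtain e_v where e_v: "e_v \<in> K" "u \<notin> e_v"
    using no_center by blast
  then have "v \<in> e_v"
    using intersect[OF e e_v(1)] uv by auto
  then obtain w where w: "e_v = {v, w}" "v \<noteq> w"
    using card2[OF e_v(1)] by (auto simp: card_2_iff)
  obtain e_u where e_u: "e_u \<in> K" "v \<notin> e_u"
    using no_center by blast
  then have uw: "u \<in> e_u" "w \<in> e_u" "u \<noteq> w"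
    using intersect[OF e e_u(1)] intersect[OF e_v(1) e_u(1)] uv w e_v(2) by auto
  have "x \<in> {{u, v}, {v, w}, {u, w}}" if x: "x \<in> K" for x
  proof -
    have "x \<inter> {u, v} \<noteq> {}" "x \<inter> {v, w} \<noteq> {}" "x \<inter> {u, w} \<noteq> {}"
      using intersect[OF x e] intersect[OF x e_v(1)] intersect[OF x e_u(1)]
        uv(1) w(1) edge_eq[OF e_u(1) uw] by auto
    then consider "u \<in> x" "v \<in> x" | "v \<in> x" "w \<in> x" | "u \<in> x" "w \<in> x" by blast
    then show ?thesis
      using edge_eq[OF x] uv(2) w(2) uw(3) by cases auto
  qed
  then have "K \<subseteq> {{u, v}, {v, w}, {u, w}}" by blast
  then show ?thesis by blast
qed blast

lemma card_intersecting_edges_le: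
  assumes K: "\<forall>e\<in>K. card e = 2" and meet: "\<forall>e\<in>K. \<forall>e'\<in>K. e \<inter> e' \<noteq> {}"
    and deg: "\<And>v. degree K v \<le> k" and k: "3 \<le> k"
  shows "card K \<le> k"
  using intersecting_edges_star_or_triangle[OF K meet]
proof (elim disjE exE)
  fix v assume "\<forall>e\<in>K. v \<in> e"
  then have "edges_at K v = K"
    by (auto simp: edges_at_def)
  then show ?thesis
    using deg[of v] by (simp add: degree_def)
next
  fix u v w assume "K \<subseteq> {{u, v}, {v, w}, {u, w}}"
  then have "card K \<le> card {{u, v}, {v, w}, {u, w}}"
    by (intro card_mono) auto
  also have "\<dots> \<le> 3"
    by (simp add: card_insert_if)
  finally show ?thesis
    using k by simp
qed

lemma clique_number_le:
  assumes fin: "finite (verts G)" and le: "\<And>Q. clique G Q \<Longrightarrow> card Q \<le> n"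
  shows "clique_number G \<le> n"
  unfolding clique_number_def
proof (rule Max.boundedI)
  have "{card Q | Q. clique G Q} \<subseteq> card ` Pow (verts G)"
    unfolding clique_def by auto
  then show "finite {card Q | Q. clique G Q}"
    using fin finite_subset by blast
  have "clique G {}"
    unfolding clique_def by simp
  then show "{card Q | Q. clique G Q} \<noteq> {}" by blast
qed (use le in auto)

lemma chromatic_number_coloring:
  assumes fin: "finite (verts G)"
    and edges: "\<And>u v. {u, v} \<in> edges G \<Longrightarrow> u \<in> verts G \<and> v \<in> verts G \<and> u \<noteq> v"
  obtains c where "proper_vertex_coloring G (chromatic_number G) c"
proof -
  obtain b :: "'a \<Rightarrow> nat" where b: "bij_betw b (verts G) {1..card (verts G)}"
    using finite_same_card_bij[OF fin, of "{1..card (verts G)}"] by auto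
  have "proper_vertex_coloring G (card (verts G)) (restrict b (verts G))"
    using b edges by (auto simp: proper_vertex_coloring_def bij_betw_def dest: inj_onD)
  then have "\<exists>c. proper_vertex_coloring G (card (verts G)) c" by blast
  then have "\<exists>c. proper_vertex_coloring G (chromatic_number G) c"
    unfolding chromatic_number_def by (rule LeastI)
  then show thesis
    using that by blast
qed

lemma clique_line_graph_intersecting:
  assumes Q: "clique (induced_subgraph (line_graph G) K) Q" and e: "e \<in> Q" "e' \<in> Q" "e \<noteq> {}"
  shows "e \<inter> e' \<noteq> {}"
proof (cases "e = e'")
  case False
  then have "{e, e'} \<in> edges (line_graph G)"
    using Q e unfolding clique_def induced_subgraph_def by auto
  then show ?thesis
    by (auto simp: line_graph_def adjacent_edges_def doubleton_eq_iff)
qed (use e in auto)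

lemma proper_vertex_coloring_line_graph:
  assumes c: "proper_vertex_coloring (induced_subgraph (line_graph G) K) n c" and K: "K \<subseteq> edges G"
  shows "proper_on K {1..n} c"
proof (rule proper_onI)
  show "c e \<in> {1..n}" if "e \<in> K" for e
    using that c by (auto simp: proper_vertex_coloring_def induced_subgraph_def)
  fix v e e'
  assume e: "e \<in> K" "e' \<in> K" "v \<in> e" "v \<in> e'" "c e = c e'"
  show "e = e'"
  proof (rule ccontr)
    assume "e \<noteq> e'"
    then have "{e, e'} \<in> edges (induced_subgraph (line_graph G) K)"
      using e K by (auto simp: induced_subgraph_def line_graph_def adjacent_edges_def)
    then show False
      using c e(5) by (auto simp: proper_vertex_coloring_def)
  qed
qed

lemma simple_graph_finite_edges: "simple_graph G \<Longrightarrow> finite (edges G)"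
  unfolding simple_graph_def by (meson Pow_iff finite_Pow_iff finite_subset subsetI)

lemma simple_graph_card_edge: "simple_graph G \<Longrightarrow> e \<in> edges G \<Longrightarrow> card e = 2"
  unfolding simple_graph_def by blast

lemma clique_number_line_graph_le:
  assumes G: "simple_graph G" and K: "K \<subseteq> edges G"
    and deg: "\<And>v. degree K v \<le> k" and k: "3 \<le> k"
  shows "clique_number (induced_subgraph (line_graph G) K) \<le> k"
proof (rule clique_number_le)
  let ?L = "induced_subgraph (line_graph G) K"
  have finK: "finite K"
    using K simple_graph_finite_edges[OF G] by (rule finite_subset)
  have verts_L: "verts ?L = K"
    by (simp add: induced_subgraph_def)
  show "finite (verts ?L)"
    using finK verts_L by simp
  show "card Q \<le> k" if Q: "clique ?L Q" for Q
  proof (rule card_intersecting_edges_le)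
    have "Q \<subseteq> K"
      using Q by (simp add: clique_def verts_L)
    then show card2: "\<forall>e\<in>Q. card e = 2"
      using K simple_graph_card_edge[OF G] by blast
    show "\<forall>e\<in>Q. \<forall>e'\<in>Q. e \<inter> e' \<noteq> {}"
    proof (intro ballI)
      fix e e' assume e: "e \<in> Q" "e' \<in> Q"
      then have "e \<noteq> {}"
        using card2 by force
      with e show "e \<inter> e' \<noteq> {}"
        by (rule clique_line_graph_intersecting[OF Q])
    qed
    show "degree Q v \<le> k" for v
      using degree_mono[OF finK \<open>Q \<subseteq> K\<close>, of v] deg[of v] by simp
  qed (rule k)
qed

lemma line_perfect_proper_on:
  assumes G: "simple_graph G" "line_perfect G" and K: "K \<subseteq> edges G"
    and deg: "\<And>v. degree K v \<le> k" and k: "3 \<le> k"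
  obtains c where "proper_on K {1..k} c"
proof -
  let ?L = "induced_subgraph (line_graph G) K"
  have finK: "finite K"
    using K simple_graph_finite_edges[OF G(1)] by (rule finite_subset)
  have verts_L: "verts ?L = K"
    by (simp add: induced_subgraph_def)
  have "clique_number ?L \<le> k"
    using G(1) K deg k by (rule clique_number_line_graph_le)
  moreover have "chromatic_number ?L = clique_number ?L"
    using G(2) K by (simp add: line_perfect_def perfect_graph_def line_graph_def)
  moreover obtain c where c: "proper_vertex_coloring ?L (chromatic_number ?L) c"
  proof (rule chromatic_number_coloring)
    show "finite (verts ?L)"
      using finK verts_L by simp
    show "e \<in> verts ?L \<and> e' \<in> verts ?L \<and> e \<noteq> e'" if "{e, e'} \<in> edges ?L" for e e'
      using that
      by (auto simp: induced_subgraph_def line_graph_def adjacent_edges_def doubleton_eq_iff)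
  qed
  ultimately have "proper_on K {1..chromatic_number ?L} c" "chromatic_number ?L \<le> k"
    using proper_vertex_coloring_line_graph[OF _ K] by auto
  then have "proper_on K {1..k} c"
    by (auto simp: proper_on_def)
  then show thesis by (rule that)
qed

lemma line_perfect_degree_colorable:
  assumes G: "simple_graph G" "line_perfect G" and k: "3 \<le> k"
  shows "degree_colorable (edges G) k"
proof
  show "\<exists>f :: 'a set \<Rightarrow> nat. proper_on K {1..k} f"
    if "K \<subseteq> edges G" "\<And>v. degree K v \<le> k" for K
    using line_perfect_proper_on[OF G that k] by blast
qed (use G k in \<open>auto intro: simple_graph_finite_edges simple_graph_card_edge\<close>)

theorem corollary4p3:
  fixes G :: "'a graph"
  assumes "simple_graph G"
    and "line_perfect G"
  shows "chi_trans G \<le> 4"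
  unfolding chi_trans_def
proof (intro Least_le conjI allI impI)
  fix f g
  let ?t = "chromatic_index G"
  assume f: "proper_coloring G ?t f" and g: "proper_coloring G ?t g"
  have "degree_colorable (edges G) 3"
    using assms by (rule line_perfect_degree_colorable) simp
  then have "(recolor_step 4 (edges G) {1..?t})\<^sup>*\<^sup>* f g"
    using recolor_steps_connected[of "{1..?t}" "edges G" 3 f g] f g
    by (simp add: proper_coloring_iff)
  then have "n_equivalent G ?t 4 (restrict f (edges G)) (restrict g (edges G))"
    using recolor_steps_n_equivalent f unfolding proper_coloring_iff by blast
  then show "n_equivalent G ?t 4 f g"
    using f g by (simp add: proper_coloring_iff extensional_restrict)
qed simp

end
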